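(* Let $a,b,c,d$ be nonzero real numbers. The solutions of the equation $$(bd-ac)^2x^4-2b(bd-ac)x^3+(b^2+cd)x^2-cx=0$$ are $x=0$ and, in addition, the following: 1) If $bd=ac$ and $b^2+cd\neq0$, then $x=\dfrac{c}{b^2+cd}$. 2) If $bd\neq ac$, let $$p=\frac{3cd-b^2}{3(bd-ac)^2},\qquad q=\frac{2(9bcd+b^3)}{27(bd-ac)^3}-\frac{c}{(bd-ac)^2},\qquad \Delta=\Big(\frac q2\Big)^2+\Big(\frac p3\Big)^3.$$ Then a) for $\Delta<0$ there exist three real solutions; b) for $\Delta>0$ there is one real solution and two complex conjugate solutions; c) for $\Delta=0$ and $p\neq0$, $q\ne0$ there are two real solutions; d) for $\Delta=0$ and $p=q=0$ there exists one real solution, namely $x=\dfrac{2b}{3(bd-ac)}$.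
   Context: The equation arises from the idempotent elements ($x^2=x$) of the two-dimensional real evolution algebra with basis $e_1,e_2$, $e_1e_2=e_2e_1=0$, $e_1e_1=a_{12}e_2+a_{11}e_1$, $e_2e_2=a_{21}e_1+a_{22}e_2$, all $a_{ij}\ne0$, with the notation $a=a_{12}$, $b=a_{22}$, $c=a_{21}$, $d=a_{11}$; the idempotents $xe_1+ye_2$ satisfy $ax^2+by^2=y$, $dx^2+cy^2=x$, from which the stated equation for $x$ is derived. The solutions counted in a)–d) are the distinct solutions other than $x=0$. *)

theory Defs
  imports Complex_Main
begin

definition quartic_solutions :: "real \<Rightarrow> real \<Rightarrow> real \<Rightarrow> real \<Rightarrow> complex set" where
  "quartic_solutions a b c d =
     {x. of_real ((b * d - a * c)\<^sup>2) * x ^ 4 - of_real (2 * b * (b * d - a * c)) * x ^ 3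
         + of_real (b\<^sup>2 + c * d) * x\<^sup>2 - of_real c * x = 0}"

text \<open>
  If \<open>b * d \<noteq> a * c\<close>, then dividing the quartic by \<open>(b * d - a * c)\<^sup>2 * x\<close> and
  substituting \<open>x = t + 2 * b / (3 * (b * d - a * c))\<close> gives the depressed cubic
  \<open>t ^ 3 + p * t + q\<close>. The next three definitions are its two coefficients and Cardano's
  discriminant; they are meaningful only for \<open>b * d \<noteq> a * c\<close>.
\<close>

definition cubic_p :: "real \<Rightarrow> real \<Rightarrow> real \<Rightarrow> real \<Rightarrow> real" where
  "cubic_p a b c d = (3 * c * d - b\<^sup>2) / (3 * (b * d - a * c)\<^sup>2)"

definition cubic_q :: "real \<Rightarrow> real \<Rightarrow> real \<Rightarrow> real \<Rightarrow> real" where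
  "cubic_q a b c d =
     2 * (9 * b * c * d + b ^ 3) / (27 * (b * d - a * c) ^ 3) - c / (b * d - a * c)\<^sup>2"

definition cubic_Delta :: "real \<Rightarrow> real \<Rightarrow> real \<Rightarrow> real \<Rightarrow> real" where
  "cubic_Delta a b c d = (cubic_q a b c d / 2)\<^sup>2 + (cubic_p a b c d / 3) ^ 3"

end

theory Submission
  imports Defs
begin

text \<open>
  Let \<open>K = b * d - a * c\<close>. For \<open>K = 0\<close> the quartic collapses to \<open>x * ((b\<^sup>2 + c * d) * x - c)\<close>.
  For \<open>K \<noteq> 0\<close> the cubic that remains after splitting off the factor \<open>x\<close> has the constant term
  \<open>- c \<noteq> 0\<close>, so the nonzero solutions are exactly its roots, and these are the roots of
  \<open>t ^ 3 + p * t + q\<close> shifted by \<open>2 * b / (3 * K)\<close> (\<open>nonzero_quartic_solutions_eq_shifted_roots\<close>).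

  It remains to classify the complex roots of a real depressed cubic, which needs no radicals.
  Such a cubic has a real root \<open>r\<close>, and dividing by \<open>t - r\<close> leaves the quadratic
  \<open>t\<^sup>2 + r * t + (r\<^sup>2 + p)\<close>, whose discriminant is \<open>- 3 * r\<^sup>2 - 4 * p\<close>. The identity
  \<open>- 108 * ((q / 2)\<^sup>2 + (p / 3) ^ 3) = (- 3 * r\<^sup>2 - 4 * p) * (3 * r\<^sup>2 + p)\<^sup>2\<close>
  (\<open>cardano_discriminant_via_real_root\<close>) shows that a nonzero Cardano discriminant has the
  sign opposite to that of the quadratic's discriminant. The second factor is the squared value of
  the quadratic at \<open>r\<close>, so \<open>r\<close> is then a simple root. When Cardano's discriminant vanishes, the
  cubic is \<open>t ^ 3\<close> if \<open>p = q = 0\<close>; if \<open>p \<noteq> 0\<close>, it has the double root \<open>- 3 * q / (2 * p)\<close> and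
  factors explicitly (\<open>depressed_cubic_double_root\<close>).
\<close>

section \<open>Complex roots of a real depressed cubic\<close>

definition depressed_cubic_roots :: "real \<Rightarrow> real \<Rightarrow> complex set" where
  "depressed_cubic_roots p q = {t. t ^ 3 + of_real p * t + of_real q = 0}"

text \<open>
  The cubic term dominates at \<open>\<plusminus> M\<close> for \<open>M = 1 + \<bar>p\<bar> + \<bar>q\<bar>\<close>, since \<open>M ^ 2 \<ge> M\<close> gives
  \<open>M ^ 3 \<ge> (1 + \<bar>p\<bar> + \<bar>q\<bar>) * M \<ge> \<bar>p\<bar> * M + \<bar>q\<bar>\<close>; the intermediate value theorem does the rest.
\<close>

lemma depressed_cubic_has_real_root:
  fixes p q :: real
  obtains r where "r ^ 3 + p * r + q = 0"
proof -
  define M where "M = 1 + \<bar>p\<bar> + \<bar>q\<bar>"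
  have M1: "M \<ge> 1" by (simp add: M_def)
  have "M * M \<ge> M" using M1 by simp
  then have "M ^ 3 \<ge> M * M"
    using M1 by (simp add: power3_eq_cube mult_le_cancel_left)
  moreover have "M * M = M + \<bar>p\<bar> * M + \<bar>q\<bar> * M"
    by (subst (1) M_def) (simp add: algebra_simps)
  moreover have "\<bar>q\<bar> * M \<ge> \<bar>q\<bar>" using mult_left_mono[OF M1, of "\<bar>q\<bar>"] by simp
  moreover have "\<bar>p * M\<bar> = \<bar>p\<bar> * M" using M1 by (simp add: abs_mult)
  ultimately have "\<bar>p * M\<bar> + \<bar>q\<bar> \<le> M ^ 3" using M1 by linarith
  then have lo: "(- M) ^ 3 + p * (- M) + q \<le> 0" and hi: "0 \<le> M ^ 3 + p * M + q"
    using abs_ge_self[of "p * M"] abs_ge_minus_self[of "p * M"]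
      abs_ge_self[of q] abs_ge_minus_self[of q] by simp_all
  have "\<exists>r. - M \<le> r \<and> r \<le> M \<and> r ^ 3 + p * r + q = 0"
    using M1 lo hi by (intro IVT) (auto intro!: continuous_intros)
  then show ?thesis using that by blast
qed

lemma cardano_discriminant_via_real_root:
  fixes p q r :: real
  assumes "r ^ 3 + p * r + q = 0"
  shows "- 108 * ((q / 2)\<^sup>2 + (p / 3) ^ 3) = (- 3 * r\<^sup>2 - 4 * p) * (3 * r\<^sup>2 + p)\<^sup>2"
proof -
  have "q = - (r ^ 3) - p * r" using assms by linarith
  then have "- 27 * q\<^sup>2 - 4 * p ^ 3 = (- 3 * r\<^sup>2 - 4 * p) * (3 * r\<^sup>2 + p)\<^sup>2"
    by algebra
  moreover have "- 108 * ((q / 2)\<^sup>2 + (p / 3) ^ 3) = - 27 * q\<^sup>2 - 4 * p ^ 3"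
    by (simp add: power_divide)
  ultimately show ?thesis by simp
qed

text \<open>
  A square root \<open>w\<close> of the discriminant, real or imaginary, splits the quadratic cofactor over the
  complex numbers; this serves both signs of Cardano's discriminant.
\<close>

lemma depressed_cubic_roots_eq:
  fixes p q r :: real and w :: complex
  assumes root: "r ^ 3 + p * r + q = 0" and w: "w\<^sup>2 = of_real (- 3 * r\<^sup>2 - 4 * p)"
  shows "depressed_cubic_roots p q =
    {of_real r, (- of_real r + w) / 2, (- of_real r - w) / 2}"
proof -
  have "q = - (r ^ 3) - p * r" using root by linarith
  then have q: "of_real q = - (of_real r ^ 3) - of_real p * (of_real r :: complex)" by simp
  have w': "w\<^sup>2 = - 3 * (of_real r)\<^sup>2 - 4 * of_real p"
    using w by simp
  have "t ^ 3 + of_real p * t + of_real q =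
      (t - of_real r) * (t - (- of_real r + w) / 2) * (t - (- of_real r - w) / 2)" for t :: complex
  proof -
    have half: "(t - (- of_real r + w) / 2) * (t - (- of_real r - w) / 2) =
        ((2 * t + of_real r)\<^sup>2 - w\<^sup>2) / 4"
      by (simp add: field_simps power2_eq_square)
    have "(2 * t + of_real r)\<^sup>2 - w\<^sup>2 =
        4 * (t\<^sup>2 + of_real r * t + (of_real r)\<^sup>2 + of_real p)"
      using w' by algebra
    then have "(t - (- of_real r + w) / 2) * (t - (- of_real r - w) / 2) =
        t\<^sup>2 + of_real r * t + (of_real r)\<^sup>2 + of_real p"
      unfolding half by simp
    then show ?thesis unfolding mult.assoc using q by algebra
  qed
  then show ?thesis by (auto simp: depressed_cubic_roots_def)
qed

lemma depressed_cubic_three_real_roots: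
  fixes p q :: real
  assumes neg: "(q / 2)\<^sup>2 + (p / 3) ^ 3 < 0"
  obtains t1 t2 t3 :: real where "distinct [t1, t2, t3]"
    and "depressed_cubic_roots p q = {of_real t1, of_real t2, of_real t3}"
proof -
  obtain r where r: "r ^ 3 + p * r + q = 0" by (rule depressed_cubic_has_real_root)
  define D where "D = - 3 * r\<^sup>2 - 4 * p"
  have "D * (3 * r\<^sup>2 + p)\<^sup>2 > 0"
    unfolding D_def cardano_discriminant_via_real_root[OF r, symmetric]
    using neg by (intro mult_neg_neg) auto
  then have D: "D > 0" and simple: "3 * r\<^sup>2 + p \<noteq> 0"
    by (auto simp: zero_less_mult_iff)
  define s where "s = sqrt D"
  have s: "s > 0" "s\<^sup>2 = D" using D by (auto simp: s_def)
  have "depressed_cubic_roots p q =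
      {of_real r, of_real ((- r + s) / 2), of_real ((- r - s) / 2)}"
    using depressed_cubic_roots_eq[OF r, of "of_real s"] s(2)
    by (simp add: D_def flip: of_real_power)
  moreover have "distinct [r, (- r + s) / 2, (- r - s) / 2]"
  proof -
    \<comment> \<open>A coincidence with \<open>r\<close> forces \<open>s = \<plusminus> 3 * r\<close>, and then \<open>12 * r\<^sup>2 + 4 * p = 0\<close>.\<close>
    have "s\<^sup>2 \<noteq> (3 * r)\<^sup>2" using simple s(2) by (auto simp: D_def power_mult_distrib)
    then have "s \<noteq> 3 * r" "s \<noteq> - 3 * r" by auto
    then show ?thesis using s(1) by (auto simp: field_simps)
  qed
  ultimately show ?thesis using that by blast
qed

lemma depressed_cubic_one_real_root:
  fixes p q :: real
  assumes pos: "(q / 2)\<^sup>2 + (p / 3) ^ 3 > 0"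
  obtains r :: real and z :: complex where "z \<notin> \<real>"
    and "depressed_cubic_roots p q = {of_real r, z, cnj z}"
proof -
  obtain r where r: "r ^ 3 + p * r + q = 0" by (rule depressed_cubic_has_real_root)
  define D where "D = - 3 * r\<^sup>2 - 4 * p"
  have "D * (3 * r\<^sup>2 + p)\<^sup>2 < 0"
    unfolding D_def cardano_discriminant_via_real_root[OF r, symmetric]
    using pos by (intro mult_neg_pos) auto
  then have D: "D < 0" by (auto simp: mult_less_0_iff not_less)
  define s where "s = sqrt (- D)"
  have s: "s > 0" "s\<^sup>2 = - D" using D by (auto simp: s_def)
  define z where "z = (- of_real r + \<i> * of_real s) / 2"
  have "(\<i> * of_real s)\<^sup>2 = (of_real D :: complex)"
    using s(2) by (simp add: power_mult_distrib flip: of_real_power)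
  moreover have "cnj z = (- of_real r - \<i> * of_real s) / 2" by (simp add: z_def)
  ultimately have "depressed_cubic_roots p q = {of_real r, z, cnj z}"
    using depressed_cubic_roots_eq[OF r, of "\<i> * of_real s"]
    by (simp only: D_def z_def)
  moreover have "z \<notin> \<real>" using s(1) by (simp add: z_def complex_is_Real_iff)
  ultimately show ?thesis using that by blast
qed

text \<open>
  With a double root \<open>- s\<close> the vanishing sum of the roots makes the third root \<open>2 * s\<close>, and comparing
  coefficients in \<open>(t - 2 * s) * (t + s)\<^sup>2 = t ^ 3 - 3 * s\<^sup>2 * t - 2 * s ^ 3\<close> yields
  \<open>s = 3 * q / (2 * p)\<close>.
\<close>

lemma depressed_cubic_double_root:
  fixes p q :: real
  assumes zero: "(q / 2)\<^sup>2 + (p / 3) ^ 3 = 0" and p: "p \<noteq> 0"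
  shows "depressed_cubic_roots p q = {of_real (3 * q / p), of_real (- (3 * q / (2 * p)))}"
proof -
  define s where "s = 3 * q / (2 * p)"
  have disc: "27 * q\<^sup>2 = - 4 * p ^ 3"
    using zero by (simp add: field_simps)
  have q: "q = 2 * p * s / 3" using p by (simp add: s_def)
  have "p\<^sup>2 * (3 * s\<^sup>2) = p\<^sup>2 * (- p)"
    using disc unfolding q by (simp add: power2_eq_square power3_eq_cube algebra_simps)
  then have "3 * s\<^sup>2 = - p" using p by (simp only: mult_cancel_left) simp
  then have ps: "p = - 3 * s\<^sup>2" by simp
  then have qs: "q = - 2 * s ^ 3" using q by (simp add: power2_eq_square power3_eq_cube)
  have "t ^ 3 + of_real p * t + of_real q = (t - of_real (2 * s)) * (t - of_real (- s))\<^sup>2"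
    for t :: complex
    unfolding ps qs by simp algebra
  then have "depressed_cubic_roots p q = {of_real (2 * s), of_real (- s)}"
    by (auto simp: depressed_cubic_roots_def eq_neg_iff_add_eq_0)
  moreover have "2 * s = 3 * q / p" by (simp add: s_def)
  ultimately show ?thesis by (simp add: s_def)
qed

section \<open>Solutions of the quartic\<close>

lemma quartic_solutions_degenerate:
  assumes "b * d = a * c"
  shows "quartic_solutions a b c d - {0} = {x. x \<noteq> 0 \<and> of_real (b\<^sup>2 + c * d) * x = of_real c}"
proof -
  have "of_real (b\<^sup>2 + c * d) * x\<^sup>2 - of_real c * x = x * (of_real (b\<^sup>2 + c * d) * x - of_real c)"
    for x :: complex
    by (simp add: power2_eq_square algebra_simps)
  then show ?thesis using assms by (auto simp: quartic_solutions_def)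
qed

text \<open>
  With \<open>K = b * d - a * c\<close>, factoring \<open>K\<^sup>2 * x\<close> out of the quartic leaves the depressed cubic,
  evaluated at \<open>x - 2 * b / (3 * K)\<close>. No root
  of the cubic is lost by removing \<open>0\<close>, where the quartic divided by \<open>x\<close> equals \<open>- c\<close>.
\<close>

lemma nonzero_quartic_solutions_eq_shifted_roots:
  fixes a b c d :: real
  assumes K: "b * d \<noteq> a * c" and c: "c \<noteq> 0"
  shows "quartic_solutions a b c d - {0} =
    (\<lambda>t. t + of_real (2 * b / (3 * (b * d - a * c)))) `
      depressed_cubic_roots (cubic_p a b c d) (cubic_q a b c d)"
proof -
  define k where "k = b * d - a * c"
  define h where "h = 2 * b / (3 * k)"
  define p where "p = cubic_p a b c d"
  define q where "q = cubic_q a b c d"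
  have k: "k \<noteq> 0" using K by (simp add: k_def)
  \<comment> \<open>The coefficient comparison is over the reals, where division by \<open>k\<close> can be cleared.\<close>
  have e2: "k\<^sup>2 * (3 * h) = 2 * b * k"
    using k by (simp add: h_def power2_eq_square)
  have e1: "k\<^sup>2 * (3 * h\<^sup>2 + p) = b\<^sup>2 + c * d"
    using k by (simp add: h_def p_def cubic_p_def flip: k_def)
      (simp add: field_simps power2_eq_square)
  have e0: "k\<^sup>2 * (h ^ 3 + p * h - q) = c"
    using k by (simp add: h_def p_def q_def cubic_p_def cubic_q_def flip: k_def)
      (simp add: field_simps power2_eq_square power3_eq_cube)
  have factor: "of_real (k\<^sup>2) * x ^ 4 - of_real (2 * b * k) * x ^ 3
      + of_real (b\<^sup>2 + c * d) * x\<^sup>2 - of_real c * x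
      = of_real (k\<^sup>2) * x * ((x - of_real h) ^ 3 + of_real p * (x - of_real h) + of_real q)"
    for x :: complex
    unfolding e1[symmetric] e2[symmetric] unfolding e0[symmetric]
    by simp algebra
  have nz: "(0 - of_real h) ^ 3 + of_real p * (0 - of_real h) + of_real q \<noteq> (0 :: complex)"
  proof
    assume "(0 - of_real h) ^ 3 + of_real p * (0 - of_real h) + of_real q = (0 :: complex)"
    then have "of_real ((- h) ^ 3 + p * (- h) + q) = (0 :: complex)" by simp
    then have "(- h) ^ 3 + p * (- h) + q = 0" by (simp only: of_real_eq_0_iff)
    then have "h ^ 3 + p * h - q = 0" by simp
    then show False using e0 c by simp
  qed
  have "x \<in> quartic_solutions a b c d - {0} \<longleftrightarrow> x - of_real h \<in> depressed_cubic_roots p q" for x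
  proof -
    have "x \<in> quartic_solutions a b c d \<longleftrightarrow>
        x = 0 \<or> x - of_real h \<in> depressed_cubic_roots p q"
      unfolding quartic_solutions_def depressed_cubic_roots_def k_def[symmetric] mem_Collect_eq factor
      using k by simp
    moreover have "0 - of_real h \<notin> depressed_cubic_roots p q"
      using nz unfolding depressed_cubic_roots_def mem_Collect_eq .
    ultimately show ?thesis by auto
  qed
  moreover have "x \<in> (\<lambda>t. t + of_real h) ` R \<longleftrightarrow> x - of_real h \<in> R" for x and R :: "complex set"
    by (metis (no_types) add_diff_cancel diff_add_cancel image_iff)
  ultimately have "quartic_solutions a b c d - {0} = (\<lambda>t. t + of_real h) ` depressed_cubic_roots p q"
    by (intro set_eqI) (simp only:)
  then show ?thesis by (simp only: h_def p_def q_def k_def)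
qed

theorem theorem4:
  fixes a b c d :: real
  assumes "a \<noteq> 0" and "b \<noteq> 0" and "c \<noteq> 0" and "d \<noteq> 0"
  shows "0 \<in> quartic_solutions a b c d
    \<and> (b * d = a * c \<and> b\<^sup>2 + c * d \<noteq> 0 \<longrightarrow>
         quartic_solutions a b c d - {0} = {of_real (c / (b\<^sup>2 + c * d))})
    \<and> (b * d = a * c \<and> b\<^sup>2 + c * d = 0 \<longrightarrow> quartic_solutions a b c d - {0} = {})
    \<and> (b * d \<noteq> a * c \<longrightarrow>
         (cubic_Delta a b c d < 0 \<longrightarrow>
            (\<exists>x1 x2 x3 :: real. distinct [x1, x2, x3]
               \<and> quartic_solutions a b c d - {0} = {of_real x1, of_real x2, of_real x3}))
       \<and> (cubic_Delta a b c d > 0 \<longrightarrow>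
            (\<exists>(x1 :: real) (z :: complex). z \<notin> \<real>
               \<and> quartic_solutions a b c d - {0} = {of_real x1, z, cnj z}))
       \<and> (cubic_Delta a b c d = 0 \<and> cubic_p a b c d \<noteq> 0 \<and> cubic_q a b c d \<noteq> 0 \<longrightarrow>
            (\<exists>x1 x2 :: real. x1 \<noteq> x2
               \<and> quartic_solutions a b c d - {0} = {of_real x1, of_real x2}))
       \<and> (cubic_Delta a b c d = 0 \<and> cubic_p a b c d = 0 \<and> cubic_q a b c d = 0 \<longrightarrow>
            quartic_solutions a b c d - {0} = {of_real (2 * b / (3 * (b * d - a * c)))}))"
proof -
  define h where "h = 2 * b / (3 * (b * d - a * c))"
  define p where "p = cubic_p a b c d"
  define q where "q = cubic_q a b c d"
  have Delta: "cubic_Delta a b c d = (q / 2)\<^sup>2 + (p / 3) ^ 3"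
    by (simp add: cubic_Delta_def p_def q_def)
  have shift: "quartic_solutions a b c d - {0} = (\<lambda>t. t + of_real h) ` depressed_cubic_roots p q"
    if "b * d \<noteq> a * c"
    using nonzero_quartic_solutions_eq_shifted_roots[OF that \<open>c \<noteq> 0\<close>]
    by (simp only: h_def p_def q_def)
  have zero: "0 \<in> quartic_solutions a b c d"
    by (simp add: quartic_solutions_def)
  have single: "quartic_solutions a b c d - {0} = {of_real (c / (b\<^sup>2 + c * d))}"
    if "b * d = a * c" "b\<^sup>2 + c * d \<noteq> 0"
  proof -
    have "of_real (b\<^sup>2 + c * d) * x = of_real c \<longleftrightarrow> x = of_real (c / (b\<^sup>2 + c * d))" for x :: complex
    proof -
      have "of_real (b\<^sup>2 + c * d) \<noteq> (0 :: complex)" using that(2) by (simp only: of_real_eq_0_iff) simp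
      then show ?thesis unfolding of_real_divide by (auto simp: nonzero_eq_divide_eq mult.commute)
    qed
    moreover have "of_real (c / (b\<^sup>2 + c * d)) \<noteq> (0 :: complex)"
      using that(2) \<open>c \<noteq> 0\<close> by (simp only: of_real_eq_0_iff) simp
    ultimately show ?thesis unfolding quartic_solutions_degenerate[OF that(1)] by auto
  qed
  have none: "quartic_solutions a b c d - {0} = {}" if "b * d = a * c" "b\<^sup>2 + c * d = 0"
    unfolding quartic_solutions_degenerate[OF that(1)] that(2) using \<open>c \<noteq> 0\<close> by simp
  have three: "\<exists>x1 x2 x3 :: real. distinct [x1, x2, x3]
      \<and> quartic_solutions a b c d - {0} = {of_real x1, of_real x2, of_real x3}"
    if K: "b * d \<noteq> a * c" and neg: "cubic_Delta a b c d < 0"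
  proof -
    obtain t1 t2 t3 where "distinct [t1, t2, t3]"
      and "depressed_cubic_roots p q = {of_real t1, of_real t2, of_real t3}"
      using depressed_cubic_three_real_roots neg unfolding Delta by blast
    then show ?thesis unfolding shift[OF K]
      by (intro exI[of _ "t1 + h"] exI[of _ "t2 + h"] exI[of _ "t3 + h"]) simp
  qed
  have one: "\<exists>(x1 :: real) (z :: complex). z \<notin> \<real>
      \<and> quartic_solutions a b c d - {0} = {of_real x1, z, cnj z}"
    if K: "b * d \<noteq> a * c" and pos: "cubic_Delta a b c d > 0"
  proof -
    obtain r z where "z \<notin> \<real>" and "depressed_cubic_roots p q = {of_real r, z, cnj z}"
      using depressed_cubic_one_real_root pos unfolding Delta by blast
    then show ?thesis unfolding shift[OF K]
      by (intro exI[of _ "r + h"] exI[of _ "z + of_real h"]) (simp add: complex_is_Real_iff)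
  qed
  have two: "\<exists>x1 x2 :: real. x1 \<noteq> x2
      \<and> quartic_solutions a b c d - {0} = {of_real x1, of_real x2}"
    if K: "b * d \<noteq> a * c" and "cubic_Delta a b c d = 0" and p: "p \<noteq> 0" and q: "q \<noteq> 0"
  proof -
    have "depressed_cubic_roots p q = {of_real (3 * q / p), of_real (- (3 * q / (2 * p)))}"
      using depressed_cubic_double_root that(2) p unfolding Delta by blast
    moreover have "3 * q / p \<noteq> - (3 * q / (2 * p))" using p q by (simp add: field_simps)
    ultimately show ?thesis unfolding shift[OF K]
      by (intro exI[of _ "3 * q / p + h"] exI[of _ "- (3 * q / (2 * p)) + h"]) simp
  qed
  have triple: "quartic_solutions a b c d - {0} = {of_real h}"
    if K: "b * d \<noteq> a * c" and "p = 0" and "q = 0"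
    unfolding shift[OF K] using that(2,3) by (simp add: depressed_cubic_roots_def)
  show ?thesis
    by (intro conjI impI; (elim conjE)?;
        rule zero single none three one two[unfolded p_def q_def] triple[unfolded h_def p_def q_def];
        assumption)
qed

end
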